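(* Let $X$ be a pre-ordered Banach space and consider the positive parts of the closed unit balls in $X$ and $X''$, given by $$B_+ := \{x \in X_+ : \|x\| \le 1\} \quad \text{and} \quad B''_+ := \{x'' \in X''_+ : \|x''\| \le 1\}.$$ Then $B_+$ is weak* dense in $B''_+$ (where $X$ is identified with a subspace of $X''$ via the canonical embedding).
   Context: A pre-ordered Banach space is a real Banach space $X$ together with a norm closed wedge $X_+$, i.e. a norm closed non-empty subset $X_+ \subseteq X$ with $\alpha X_+ + \beta X_+ \subseteq X_+$ for all scalars $\alpha,\beta \in [0,\infty)$ (it is not required that $X_+ \cap (-X_+) = \{0\}$). The dual wedge is $X'_+ := \{x' \in X' : \langle x',x\rangle \ge 0 \text{ for all } x \in X_+\}$ and the bidual wedge is $X''_+ := \{x'' \in X'' : \langle x'',x'\rangle \ge 0 \text{ for all } x' \in X'_+\}$. The weak* topology on $X''$ is the one induced by $X'$. *)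

theory Defs
  imports "HOL-Analysis.Analysis"
begin

definition wedge :: "'a::real_vector set \<Rightarrow> bool" where
  "wedge K \<longleftrightarrow> K \<noteq> {} \<and>
    (\<forall>\<alpha>\<ge>0. \<forall>\<beta>\<ge>0. \<forall>x\<in>K. \<forall>y\<in>K. \<alpha> *\<^sub>R x + \<beta> *\<^sub>R y \<in> K)"

text \<open>The norm dual of \<open>'a\<close> is the type \<open>'a \<Rightarrow>\<^sub>L real\<close> with the operator norm. The bidual
  wedge of \<open>K\<close> is \<open>dual_wedge (dual_wedge K)\<close>.\<close>

definition dual_wedge :: "'a::real_normed_vector set \<Rightarrow> ('a \<Rightarrow>\<^sub>L real) set" where
  "dual_wedge K = {f. \<forall>x\<in>K. 0 \<le> blinfun_apply f x}"

definition positive_unit_ball :: "'a::real_normed_vector set \<Rightarrow> 'a set" where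
  "positive_unit_ball K = {x \<in> K. norm x \<le> 1}"

definition canonical_embedding :: "'a::real_normed_vector \<Rightarrow> ('a \<Rightarrow>\<^sub>L real) \<Rightarrow>\<^sub>L real" where
  "canonical_embedding = blinfun.prod_left"

lemma canonical_embedding_apply [simp]:
  "blinfun_apply (canonical_embedding x) f = blinfun_apply f x"
  by (simp add: canonical_embedding_def)

text \<open>For scalar-valued operators the topology of pointwise convergence is the weak* topology
  on the dual. It is used below for the dual of \<open>'a \<Rightarrow>\<^sub>L real\<close>, i.e. on the bidual of \<open>'a\<close>.\<close>

definition weak_star_topology :: "('a::real_normed_vector \<Rightarrow>\<^sub>L real) topology" where
  "weak_star_topology = strong_operator_topology"

end

theory Submission
  imports Defs
begin

text \<open>
  The weak* density is a Hahn--Banach argument. The essential point is a decomposition of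
  functionals: if a functional \<open>f\<close> satisfies \<open>f x \<le> s * norm x\<close> on the wedge \<open>P\<close>, then \<open>f \<le> b\<close> on
  \<open>P\<close> for some functional \<open>b\<close> of norm at most \<open>s\<close> on the whole space
  (\<open>dominating_functional_on_wedge\<close>). Since \<open>b - f\<close> is then in the dual wedge, every \<open>\<phi>\<close> in the
  positive unit ball of the bidual satisfies \<open>\<phi> f \<le> \<phi> b \<le> s\<close>
  (\<open>bidual_bounded_by_sup_on_wedge\<close>). Hence \<open>\<phi>\<close> lies in the bipolar of the positive unit ball of \<open>P\<close>.

  A basic weak* neighbourhood only tests finitely many functionals, so it remains to separate a
  point from a bounded convex set in a finite-dimensional space. The separating functional is
  the direction from an almost nearest point of the convex set to the given point
  (\<open>convex_separation_finite\<close>).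

  The decomposition comes from the sublinear functional
  \<open>x \<mapsto> inf {s * norm (x + k) - f k | k \<in> P}\<close> and from the existence of linear minorants of
  sublinear functionals. The latter holds because a minimal sublinear functional is linear.
  In both steps the construction of \<open>sublinear_minorant_wedge\<close> supplies the smaller sublinear
  functional.
\<close>

section \<open>Linear minorants of sublinear functionals\<close>

text \<open>Sublinear functionals are subadditive and positively homogeneous. Only the inequality
  \<open>p (t *\<^sub>R x) \<le> t * p x\<close> is required; as it includes \<open>t = 0\<close>,
  equality follows (\<open>sublinear_scale\<close>).\<close>

definition sublinear :: "('a::real_vector \<Rightarrow> real) \<Rightarrow> bool" where
  "sublinear p \<longleftrightarrow> (\<forall>x y. p (x + y) \<le> p x + p y) \<and> (\<forall>t\<ge>0. \<forall>x. p (t *\<^sub>R x) \<le> t * p x)"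

lemma sublinear_add: "sublinear p \<Longrightarrow> p (x + y) \<le> p x + p y"
  by (simp add: sublinear_def)

lemma sublinear_scale_le: "sublinear p \<Longrightarrow> 0 \<le> t \<Longrightarrow> p (t *\<^sub>R x) \<le> t * p x"
  by (simp add: sublinear_def)

lemma sublinear_zero:
  assumes "sublinear p" shows "p 0 = 0"
  using sublinear_add[OF assms, of 0 0] sublinear_scale_le[OF assms, of 0 0] by simp

lemma sublinear_ge_minus:
  assumes "sublinear p" shows "- p (- x) \<le> p x"
  using sublinear_add[OF assms, of x "- x"] sublinear_zero[OF assms] by simp

lemma sublinear_scale:
  assumes "sublinear p" "0 \<le> t" shows "p (t *\<^sub>R x) = t * p x"
proof (cases "t = 0")
  case True
  then show ?thesis by (simp add: sublinear_zero[OF assms(1)])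
next
  case False
  with assms have "0 < t" by simp
  then have "p x \<le> inverse t * p (t *\<^sub>R x)"
    using sublinear_scale_le[OF assms(1), of "inverse t" "t *\<^sub>R x"] by simp
  with \<open>0 < t\<close> have "t * p x \<le> p (t *\<^sub>R x)"
    by (simp add: field_simps)
  with sublinear_scale_le[OF assms] show ?thesis by (simp add: order_antisym)
qed

text \<open>A wedge of pairs \<open>(k, r)\<close> with \<open>r \<le> p k\<close> encodes the constraints \<open>r \<le> q k\<close> to be imposed on
  a linear minorant \<open>q\<close> of \<open>p\<close>; for a sublinear \<open>q\<close> they take the stronger form
  \<open>q (- k) \<le> - r\<close>.\<close>

lemma sublinear_minorant_wedge:
  fixes W :: "('a::real_vector \<times> real) set"
  assumes p: "sublinear p" and W: "wedge W" and le: "\<And>k r. (k, r) \<in> W \<Longrightarrow> r \<le> p k"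
  obtains q where "sublinear q" "\<And>x. q x \<le> p x" "\<And>k r. (k, r) \<in> W \<Longrightarrow> q (- k) \<le> - r"
proof -
  define h where "h x w = p (x + fst w) - snd w" for x and w :: "'a \<times> real"
  define q where "q x = (INF w\<in>W. h x w)" for x
  have ne: "W \<noteq> {}"
    and comb: "\<And>\<alpha> \<beta> v w. 0 \<le> \<alpha> \<Longrightarrow> 0 \<le> \<beta> \<Longrightarrow> v \<in> W \<Longrightarrow> w \<in> W \<Longrightarrow> \<alpha> *\<^sub>R v + \<beta> *\<^sub>R w \<in> W"
    using W by (auto simp: wedge_def)
  have zero: "(0, 0) \<in> W"
  proof -
    obtain w where "w \<in> W" using ne by auto
    then show ?thesis using comb[of 0 0 w w] by (simp add: zero_prod_def)
  qed
  have lower: "- p (- x) \<le> h x w" if "w \<in> W" for x w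
    using le[of "fst w" "snd w"] that sublinear_add[OF p, of "x + fst w" "- x"]
    by (simp add: h_def)
  then have bdd: "bdd_below (h x ` W)" for x by (intro bdd_belowI2)
  have q_le: "q x \<le> h x w" if "w \<in> W" for x w
    unfolding q_def by (rule cINF_lower[OF bdd that])
  have q_ge: "c \<le> q x" if "\<And>w. w \<in> W \<Longrightarrow> c \<le> h x w" for c x
    unfolding q_def by (rule cINF_greatest[OF ne that])
  have "q (x + y) \<le> q x + q y" for x y
  proof -
    have "q (x + y) \<le> h x v + h y w" if "v \<in> W" "w \<in> W" for v w
    proof -
      have "v + w \<in> W" using comb[of 1 1 v w] that by simp
      then have "q (x + y) \<le> h (x + y) (v + w)" by (rule q_le)
      also have "\<dots> \<le> h x v + h y w"
        using sublinear_add[OF p, of "x + fst v" "y + fst w"] by (simp add: h_def algebra_simps)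
      finally show ?thesis .
    qed
    then have "q (x + y) - h x v \<le> q y" if "v \<in> W" for v
      using that by (intro q_ge) (simp add: algebra_simps)
    then have "q (x + y) - q y \<le> q x"
      by (intro q_ge) (simp add: algebra_simps)
    then show ?thesis by simp
  qed
  moreover have "q (t *\<^sub>R x) \<le> t * q x" if t: "0 \<le> t" for t x
  proof (cases "t = 0")
    case True
    then show ?thesis using q_le[OF zero, of 0] sublinear_zero[OF p] by (simp add: h_def)
  next
    case False
    with t have "0 < t" by simp
    have "q (t *\<^sub>R x) / t \<le> h x w" if "w \<in> W" for w
    proof -
      have "t *\<^sub>R w \<in> W" using comb[of t 0 w w] that t by simp
      then have "q (t *\<^sub>R x) \<le> h (t *\<^sub>R x) (t *\<^sub>R w)" by (rule q_le)
      also have "\<dots> = t * h x w"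
        using sublinear_scale[OF p t, of "x + fst w"] by (simp add: h_def algebra_simps)
      finally show ?thesis using \<open>0 < t\<close> by (simp add: field_simps)
    qed
    then have "q (t *\<^sub>R x) / t \<le> q x" by (rule q_ge)
    then show ?thesis using \<open>0 < t\<close> by (simp add: field_simps)
  qed
  ultimately have "sublinear q" by (simp add: sublinear_def)
  moreover have "q x \<le> p x" for x using q_le[OF zero, of x] by (simp add: h_def)
  moreover have "q (- k) \<le> - r" if "(k, r) \<in> W" for k r
    using q_le[OF that, of "- k"] sublinear_zero[OF p] by (simp add: h_def)
  ultimately show thesis by (rule that)
qed

text \<open>Zorn's lemma: the pointwise infimum of a nonempty chain of sublinear functionals below \<open>p\<close> is
  again one, with finite values because each of them is bounded below by \<open>\<lambda>x. - p (- x)\<close>.\<close>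

lemma minimal_sublinear_minorant:
  fixes p :: "'a::real_vector \<Rightarrow> real"
  assumes p: "sublinear p"
  obtains m where "sublinear m" "m \<le> p" "\<And>q. sublinear q \<Longrightarrow> q \<le> m \<Longrightarrow> q = m"
proof -
  define A where "A = {q. sublinear q \<and> q \<le> p}"
  have "\<exists>m\<in>A. \<forall>q\<in>A. q \<le> m \<longrightarrow> q = m"
  proof (rule predicate_Zorn[where P = "\<lambda>x y. y \<le> x"])
    show "partial_order_on A (relation_of (\<lambda>x y. y \<le> x) A)"
      by (rule partial_order_on_relation_ofI) auto
  next
    fix C assume "C \<in> Chains (relation_of (\<lambda>x y. y \<le> x) A)"
    then have CA: "C \<subseteq> A" and chain: "\<And>a b. a \<in> C \<Longrightarrow> b \<in> C \<Longrightarrow> a \<le> b \<or> b \<le> a"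
      unfolding Chains_def relation_of_def by blast+
    show "\<exists>u\<in>A. \<forall>a\<in>C. u \<le> a"
    proof (cases "C = {}")
      case True
      then show ?thesis using p by (auto simp: A_def)
    next
      case ne: False
      define u where "u x = (INF a\<in>C. a x)" for x
      have sub: "sublinear a" and le_p: "a x \<le> p x" if "a \<in> C" for a x
        using that CA by (auto simp: A_def le_fun_def)
      have "- p (- x) \<le> a x" if "a \<in> C" for a x
        using sublinear_ge_minus[OF sub[OF that], of x] le_p[OF that, of "- x"] by simp
      then have bdd: "bdd_below ((\<lambda>a. a x) ` C)" for x by (intro bdd_belowI2)
      have u_le: "u x \<le> a x" if "a \<in> C" for a x
        unfolding u_def by (rule cINF_lower[OF bdd that])
      have u_ge: "c \<le> u x" if "\<And>a. a \<in> C \<Longrightarrow> c \<le> a x" for c x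
        unfolding u_def by (rule cINF_greatest[OF ne that])
      have "u (x + y) \<le> u x + u y" for x y
      proof -
        have "u (x + y) \<le> a x + b y" if ab: "a \<in> C" "b \<in> C" for a b
        proof -
          obtain c where c: "c \<in> C" "c \<le> a" "c \<le> b" using chain[OF ab] ab by auto
          have "u (x + y) \<le> c x + c y"
            using u_le[OF c(1)] sublinear_add[OF sub[OF c(1)]] order_trans by blast
          also have "\<dots> \<le> a x + b y" using c by (intro add_mono) (auto simp: le_fun_def)
          finally show ?thesis .
        qed
        then have "u (x + y) - a x \<le> u y" if "a \<in> C" for a
          using that by (intro u_ge) (metis diff_le_eq add.commute)
        then have "u (x + y) - u y \<le> u x"
          by (intro u_ge) (metis diff_le_eq add.commute)
        then show ?thesis by simp
      qed
      moreover have "u (t *\<^sub>R x) \<le> t * u x" if t: "0 \<le> t" for t x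
      proof (cases "t = 0")
        case True
        obtain a where "a \<in> C" using ne by auto
        then show ?thesis using True u_le[of a 0] sublinear_zero[OF sub[of a]] by simp
      next
        case False
        with t have "0 < t" by simp
        have "u (t *\<^sub>R x) / t \<le> a x" if "a \<in> C" for a
          using u_le[OF that, of "t *\<^sub>R x"] sublinear_scale[OF sub[OF that] t, of x] \<open>0 < t\<close>
          by (simp add: field_simps)
        then have "u (t *\<^sub>R x) / t \<le> u x" by (rule u_ge)
        then show ?thesis using \<open>0 < t\<close> by (simp add: field_simps)
      qed
      ultimately have "sublinear u" by (simp add: sublinear_def)
      moreover have "u \<le> p"
        using ne u_le le_p by (fastforce simp: le_fun_def intro: order_trans)
      ultimately show ?thesis using u_le by (auto simp: A_def le_fun_def)
    qed
  qed
  then obtain m where m: "m \<in> A" and min: "\<And>q. q \<in> A \<Longrightarrow> q \<le> m \<Longrightarrow> q = m" by blast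
  show thesis
  proof (rule that)
    show "sublinear m" "m \<le> p" using m by (auto simp: A_def)
    show "q = m" if "sublinear q" "q \<le> m" for q
      using min[of q] that m by (auto simp: A_def)
  qed
qed

lemma minimal_sublinear_imp_linear:
  fixes m :: "'a::real_vector \<Rightarrow> real"
  assumes m: "sublinear m" and min: "\<And>q. sublinear q \<Longrightarrow> q \<le> m \<Longrightarrow> q = m"
  shows "linear m"
proof -
  have neg: "m (- y) = - m y" for y
  proof -
    \<comment> \<open>The constraint \<open>q (- y) \<le> - m y\<close>, imposed along the ray of \<open>y\<close>. By minimality \<open>q = m\<close>.\<close>
    define W where "W = {(t *\<^sub>R y, t * m y) | t. 0 \<le> t}"
    have "wedge W"
      unfolding wedge_def
    proof (intro conjI allI impI ballI)
      show "W \<noteq> {}" unfolding W_def by (auto intro: exI[of _ 0])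
    next
      fix \<alpha> \<beta> :: real and v w assume "0 \<le> \<alpha>" "0 \<le> \<beta>" "v \<in> W" "w \<in> W"
      moreover from this obtain t u where "0 \<le> t" "v = (t *\<^sub>R y, t * m y)"
        "0 \<le> u" "w = (u *\<^sub>R y, u * m y)" by (auto simp: W_def)
      ultimately show "\<alpha> *\<^sub>R v + \<beta> *\<^sub>R w \<in> W"
        unfolding W_def by (auto intro!: exI[of _ "\<alpha> * t + \<beta> * u"] simp: algebra_simps)
    qed
    moreover have "r \<le> m k" if "(k, r) \<in> W" for k r
      using that sublinear_scale[OF m] by (auto simp: W_def)
    ultimately obtain q where q: "sublinear q" "\<And>x. q x \<le> m x"
      "\<And>k r. (k, r) \<in> W \<Longrightarrow> q (- k) \<le> - r"
      by (rule sublinear_minorant_wedge[OF m]) (assumption | rule that | blast)+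
    have "q = m" using min q by (simp add: le_fun_def)
    moreover have "(y, m y) \<in> W" unfolding W_def by (auto intro: exI[of _ 1])
    ultimately have "m (- y) \<le> - m y" using q(3) by blast
    then show ?thesis using sublinear_ge_minus[OF m, of y] by simp
  qed
  show ?thesis
  proof (rule linearI)
    fix x y
    show "m (x + y) = m x + m y"
      using sublinear_add[OF m, of x y] sublinear_add[OF m, of "x + y" "- y"] neg by simp
  next
    fix t x
    show "m (t *\<^sub>R x) = t *\<^sub>R m x"
    proof (cases "0 \<le> t")
      case True
      then show ?thesis by (simp add: sublinear_scale[OF m])
    next
      case False
      then show ?thesis using sublinear_scale[OF m, of "- t" x] neg[of "t *\<^sub>R x"] by simp
    qed
  qed
qed

lemma Hahn_Banach_sublinear:
  fixes p :: "'a::real_vector \<Rightarrow> real"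
  assumes "sublinear p"
  obtains g where "linear g" "\<And>x. g x \<le> p x"
  using minimal_sublinear_minorant[OF assms] minimal_sublinear_imp_linear
  by (metis le_funD)

section \<open>Decomposition of functionals bounded above on a wedge\<close>

lemma dominating_functional_on_wedge:
  fixes f :: "'a::real_normed_vector \<Rightarrow>\<^sub>L real"
  assumes P: "wedge P" and s: "0 \<le> s" and f: "\<And>x. x \<in> P \<Longrightarrow> f x \<le> s * norm x"
  obtains b :: "'a \<Rightarrow>\<^sub>L real" where "norm b \<le> s" "\<And>x. x \<in> P \<Longrightarrow> f x \<le> b x"
proof -
  have p: "sublinear (\<lambda>x::'a. s * norm x)"
    using s by (auto simp: sublinear_def distrib_left[symmetric] intro: mult_left_mono norm_triangle_ineq)
  define W where "W = (\<lambda>k. (k, blinfun_apply f k)) ` P"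
  have "wedge W"
    using P unfolding wedge_def W_def
    by (auto simp: blinfun.add_right[symmetric] blinfun.scaleR_right[symmetric]
        simp flip: real_scaleR_def)
  moreover have "r \<le> s * norm k" if "(k, r) \<in> W" for k r
    using that f by (auto simp: W_def)
  ultimately obtain q where q: "sublinear q" "\<And>x. q x \<le> s * norm x"
    "\<And>k r. (k, r) \<in> W \<Longrightarrow> q (- k) \<le> - r"
    by (rule sublinear_minorant_wedge[OF p]) (assumption | rule that | blast)+
  obtain g where g: "linear g" "\<And>x. g x \<le> q x" by (rule Hahn_Banach_sublinear[OF q(1)]) blast
  have g_le: "g x \<le> s * norm x" for x using g(2) q(2) order_trans by blast
  have bound: "norm (g x) \<le> s * norm x" for x
    using g_le[of x] g_le[of "- x"] linear_neg[OF g(1), of x] by auto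
  have "bounded_linear g"
    using g(1) bound by (auto intro!: bounded_linear_intro[where K = s]
        simp: linear_add linear_scale mult.commute)
  then have b: "blinfun_apply (Blinfun g) = g" by (rule bounded_linear_Blinfun_apply)
  show thesis
  proof (rule that)
    show "norm (Blinfun g) \<le> s"
      using s bound by (intro norm_blinfun_bound) (simp_all add: b)
    show "f x \<le> Blinfun g x" if "x \<in> P" for x
      using g(2)[of "- x"] q(3)[of x "f x"] that linear_neg[OF g(1), of x]
      by (simp add: W_def b)
  qed
qed

lemma bidual_bounded_by_sup_on_wedge:
  fixes f :: "'a::real_normed_vector \<Rightarrow>\<^sub>L real"
  assumes P: "wedge P" and \<phi>: "\<phi> \<in> positive_unit_ball (dual_wedge (dual_wedge P))"
    and f: "\<And>x. x \<in> positive_unit_ball P \<Longrightarrow> f x \<le> s"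
  shows "\<phi> f \<le> s"
proof -
  have scale: "t *\<^sub>R x \<in> P" if "x \<in> P" "0 \<le> t" for t x
    using P that unfolding wedge_def by (metis add.right_neutral order_refl scaleR_zero_left)
  have zero: "0 \<in> P" using P scale[where t = 0] by (auto simp: wedge_def)
  have s: "0 \<le> s" using f[of 0] zero by (simp add: positive_unit_ball_def blinfun.zero_right)
  have "f x \<le> s * norm x" if "x \<in> P" for x
  proof (cases "x = 0")
    case False
    then have "f (inverse (norm x) *\<^sub>R x) \<le> s"
      using that by (intro f) (simp add: positive_unit_ball_def scale)
    with False show ?thesis by (simp add: blinfun.scaleR_right field_simps)
  qed (simp add: blinfun.zero_right)
  then obtain b :: "'a \<Rightarrow>\<^sub>L real" where b: "norm b \<le> s" "\<And>x. x \<in> P \<Longrightarrow> f x \<le> b x"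
    by (rule dominating_functional_on_wedge[OF P s]) (assumption | rule that | blast)+
  have "b - f \<in> dual_wedge P" using b(2) by (simp add: dual_wedge_def blinfun.diff_left)
  then have "\<phi> f \<le> \<phi> b"
    using \<phi> by (fastforce simp: positive_unit_ball_def dual_wedge_def blinfun.diff_right)
  also have "\<dots> \<le> norm \<phi> * norm b" using norm_blinfun[of \<phi> b] by simp
  also have "\<dots> \<le> 1 * s"
    using \<phi> b(1) by (intro mult_mono) (auto simp: positive_unit_ball_def)
  finally show ?thesis by simp
qed

section \<open>Separation by finitely many functionals\<close>

text \<open>Write \<open>d y\<close> for the squared distance from \<open>(z i)\<^sub>i\<close> to \<open>(g i y)\<^sub>i\<close>. The infimum of \<open>d\<close> over
  \<open>C\<close> need not be attained. A point \<open>x\<close> of \<open>C\<close> with nearly minimal \<open>d x\<close> serves instead, and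
  comparing \<open>d x\<close> with the value of \<open>d\<close> a small step from \<open>x\<close> towards \<open>y\<close> shows that
  \<open>c i = z i - g i x\<close> separates up to an error. Boundedness controls this error.\<close>

lemma convex_separation_finite:
  fixes g :: "'i \<Rightarrow> 'a::real_vector \<Rightarrow> real"
  assumes C: "convex C" "C \<noteq> {}" and lin: "\<And>i. i \<in> I \<Longrightarrow> linear (g i)"
    and e: "0 < e" and far: "\<And>y. y \<in> C \<Longrightarrow> e \<le> (\<Sum>i\<in>I. (z i - g i y)\<^sup>2)"
    and bounded: "\<And>y. y \<in> C \<Longrightarrow> (\<Sum>i\<in>I. (z i - g i y)\<^sup>2) \<le> M"
  obtains c s where "\<And>y. y \<in> C \<Longrightarrow> (\<Sum>i\<in>I. c i * g i y) \<le> s" "s < (\<Sum>i\<in>I. c i * z i)"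
proof -
  define d where "d y = (\<Sum>i\<in>I. (z i - g i y)\<^sup>2)" for y
  define D where "D = (INF y\<in>C. d y)"
  have M: "0 < M" using C(2) e far bounded by force
  have bdd: "bdd_below (d ` C)" using far by (intro bdd_belowI2) (simp add: d_def)
  \<comment> \<open>Step length \<open>t\<close> and tolerance \<open>t * e\<close> for near-minimality give the separation error
    \<open>e / 2 + 2 * M * t\<close>, which is less than \<open>e\<close> and hence less than every value of \<open>d\<close> on \<open>C\<close>.\<close>
  define t where "t = e / (4 * M + e)"
  have t: "0 < t" "t \<le> 1" "2 * M * t < e / 2"
    using e M by (auto simp: t_def field_simps)
  have "D < D + t * e" using t e by simp
  then obtain x where x: "x \<in> C" "d x < D + t * e"
    unfolding D_def using C(2) bdd by (subst (asm) cINF_less_iff) auto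
  define c where "c i = z i - g i x" for i
  have key: "(\<Sum>i\<in>I. c i * (g i y - g i x)) \<le> e / 2 + 2 * M * t" if y: "y \<in> C" for y
  proof -
    define u where "u i = g i y - g i x" for i
    define w where "w = (1 - t) *\<^sub>R x + t *\<^sub>R y"
    have "w \<in> C" unfolding w_def using C(1) x(1) y t by (intro convexD) auto
    then have "D \<le> d w" unfolding D_def by (rule cINF_lower[OF bdd])
    also have "d w = (\<Sum>i\<in>I. (c i - t * u i)\<^sup>2)"
      unfolding d_def
    proof (rule sum.cong)
      fix i assume "i \<in> I"
      note li = lin[OF this]
      have "g i w = (1 - t) * g i x + t * g i y"
        by (simp only: w_def linear_add[OF li] linear_scale[OF li] real_scaleR_def)
      then have "z i - g i w = c i - t * u i"
        by (simp add: c_def u_def algebra_simps)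
      then show "(z i - g i w)\<^sup>2 = (c i - t * u i)\<^sup>2" by simp
    qed simp
    also have "\<dots> = d x - 2 * t * (\<Sum>i\<in>I. c i * u i) + t\<^sup>2 * (\<Sum>i\<in>I. (u i)\<^sup>2)"
      by (simp add: d_def c_def[symmetric] power2_diff power_mult_distrib sum.distrib
          sum_subtractf sum_distrib_left algebra_simps)
    finally have 1: "2 * t * (\<Sum>i\<in>I. c i * u i) \<le> t * e + t\<^sup>2 * (\<Sum>i\<in>I. (u i)\<^sup>2)"
      using x(2) by simp
    have "(\<Sum>i\<in>I. (u i)\<^sup>2) \<le> (\<Sum>i\<in>I. 2 * (z i - g i x)\<^sup>2 + 2 * (z i - g i y)\<^sup>2)"
    proof (rule sum_mono)
      fix i
      have "0 \<le> ((z i - g i x) + (z i - g i y))\<^sup>2" by simp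
      then show "(u i)\<^sup>2 \<le> 2 * (z i - g i x)\<^sup>2 + 2 * (z i - g i y)\<^sup>2"
        by (simp add: u_def power2_eq_square algebra_simps)
    qed
    also have "\<dots> \<le> 4 * M"
      using bounded[OF x(1)] bounded[OF y] by (simp add: sum.distrib sum_distrib_left[symmetric])
    finally have "t\<^sup>2 * (\<Sum>i\<in>I. (u i)\<^sup>2) \<le> t\<^sup>2 * (4 * M)" by (rule mult_left_mono) simp
    with 1 have "(2 * t) * (\<Sum>i\<in>I. c i * u i) \<le> (2 * t) * (e / 2 + 2 * M * t)"
      by (simp add: power2_eq_square algebra_simps)
    then show ?thesis using t(1) by (simp add: u_def)
  qed
  show thesis
  proof (rule that)
    show "(\<Sum>i\<in>I. c i * g i y) \<le> (\<Sum>i\<in>I. c i * g i x) + (e / 2 + 2 * M * t)" if "y \<in> C" for y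
      using key[OF that] by (simp add: right_diff_distrib sum_subtractf)
    have "(\<Sum>i\<in>I. c i * z i) - (\<Sum>i\<in>I. c i * g i x) = d x"
      by (simp add: sum_subtractf[symmetric] d_def c_def power2_eq_square algebra_simps)
    then show "(\<Sum>i\<in>I. c i * g i x) + (e / 2 + 2 * M * t) < (\<Sum>i\<in>I. c i * z i)"
      using t(3) far[OF x(1)] by (simp add: d_def)
  qed
qed

section \<open>Weak* density\<close>

lemma convex_positive_unit_ball:
  assumes "wedge P" shows "convex (positive_unit_ball P)"
proof (rule convexI)
  fix x y and u v :: real
  assume xy: "x \<in> positive_unit_ball P" "y \<in> positive_unit_ball P" and uv: "0 \<le> u" "0 \<le> v" "u + v = 1"
  have "u *\<^sub>R x + v *\<^sub>R y \<in> P" using assms xy uv by (simp add: wedge_def positive_unit_ball_def)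
  moreover have "u *\<^sub>R x + v *\<^sub>R y \<in> cball 0 1"
    using xy uv by (intro convexD[OF convex_cball]) (auto simp: positive_unit_ball_def)
  ultimately show "u *\<^sub>R x + v *\<^sub>R y \<in> positive_unit_ball P" by (simp add: positive_unit_ball_def)
qed

lemma bidual_approximation:
  fixes P :: "'a::real_normed_vector set"
  assumes P: "wedge P" and \<phi>: "\<phi> \<in> positive_unit_ball (dual_wedge (dual_wedge P))"
    and F: "finite F" and e: "0 < e"
  obtains x where "x \<in> positive_unit_ball P" "\<And>f. f \<in> F \<Longrightarrow> \<bar>\<phi> f - blinfun_apply f x\<bar> < e"
proof -
  have "\<exists>x\<in>positive_unit_ball P. (\<Sum>f\<in>F. (\<phi> f - blinfun_apply f x)\<^sup>2) < e\<^sup>2"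
  proof (rule ccontr)
    assume "\<not> ?thesis"
    then have far: "e\<^sup>2 \<le> (\<Sum>f\<in>F. (\<phi> f - blinfun_apply f x)\<^sup>2)" if "x \<in> positive_unit_ball P" for x
      using that by (auto simp: not_less)
    have ne: "positive_unit_ball P \<noteq> {}"
    proof -
      obtain x where "x \<in> P" using P by (auto simp: wedge_def)
      then have "0 *\<^sub>R x + 0 *\<^sub>R x \<in> P" using P unfolding wedge_def by blast
      then show ?thesis by (auto simp: positive_unit_ball_def intro: exI[of _ 0])
    qed
    have bounded: "(\<Sum>f\<in>F. (\<phi> f - blinfun_apply f x)\<^sup>2) \<le> (\<Sum>f\<in>F. (2 * norm f)\<^sup>2)"
      if x: "x \<in> positive_unit_ball P" for x
    proof (rule sum_mono)
      fix f :: "'a \<Rightarrow>\<^sub>L real"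
      have "\<bar>\<phi> f\<bar> \<le> 1 * norm f"
        using norm_blinfun[of \<phi> f] \<phi> mult_right_mono[of "norm \<phi>" 1 "norm f"]
        by (simp add: positive_unit_ball_def)
      moreover have "\<bar>blinfun_apply f x\<bar> \<le> norm f * 1"
        using norm_blinfun[of f x] x mult_left_mono[of "norm x" 1 "norm f"]
        by (simp add: positive_unit_ball_def)
      ultimately have "\<bar>\<phi> f - blinfun_apply f x\<bar> \<le> \<bar>2 * norm f\<bar>" by simp
      then show "(\<phi> f - blinfun_apply f x)\<^sup>2 \<le> (2 * norm f)\<^sup>2" by (simp only: abs_le_square_iff)
    qed
    have lin: "linear (blinfun_apply f)" for f :: "'a \<Rightarrow>\<^sub>L real"
      using blinfun.bounded_linear_right bounded_linear.linear by blast
    have e2: "0 < e\<^sup>2" using e by simp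
    obtain c s where le: "\<And>x. x \<in> positive_unit_ball P \<Longrightarrow> (\<Sum>f\<in>F. c f * blinfun_apply f x) \<le> s"
      and less: "s < (\<Sum>f\<in>F. c f * \<phi> f)"
      by (rule convex_separation_finite[OF convex_positive_unit_ball[OF P] ne lin e2 far bounded])
        (assumption | rule that | blast)+
    define h where "h = (\<Sum>f\<in>F. c f *\<^sub>R f)"
    have "\<phi> h \<le> s"
      using P \<phi> by (rule bidual_bounded_by_sup_on_wedge)
        (use le in \<open>simp add: h_def blinfun.sum_left blinfun.scaleR_left\<close>)
    with less show False by (simp add: h_def blinfun.sum_right blinfun.scaleR_right)
  qed
  then obtain x where x: "x \<in> positive_unit_ball P"
    and sum: "(\<Sum>f\<in>F. (\<phi> f - blinfun_apply f x)\<^sup>2) < e\<^sup>2" by blast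
  have "\<bar>\<phi> f - blinfun_apply f x\<bar> < e" if "f \<in> F" for f
  proof -
    have "(\<phi> f - blinfun_apply f x)\<^sup>2 \<le> (\<Sum>f\<in>F. (\<phi> f - blinfun_apply f x)\<^sup>2)"
      using F that by (intro member_le_sum) auto
    with sum have "\<bar>\<phi> f - blinfun_apply f x\<bar>\<^sup>2 < e\<^sup>2" by simp
    then show ?thesis using e by (intro power2_less_imp_less[of _ e]) auto
  qed
  with x show thesis by (rule that)
qed

text \<open>A weak* open set is the preimage of an open set of the product topology on functions, so a
  basic neighbourhood constrains only finitely many coordinates.\<close>

lemma weak_star_closure_ofI:
  fixes \<phi> :: "'b::real_normed_vector \<Rightarrow>\<^sub>L real"
  assumes approx: "\<And>F e. finite F \<Longrightarrow> 0 < e \<Longrightarrow> \<exists>\<psi>\<in>S. \<forall>f\<in>F. \<bar>\<phi> f - blinfun_apply \<psi> f\<bar> < e"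
  shows "\<phi> \<in> weak_star_topology closure_of S"
  unfolding in_closure_of weak_star_topology_def
proof (intro conjI allI impI)
  show "\<phi> \<in> topspace strong_operator_topology" by (simp add: strong_operator_topology_topspace)
next
  fix T :: "('b \<Rightarrow>\<^sub>L real) set"
  assume "\<phi> \<in> T \<and> openin strong_operator_topology T"
  then obtain U where U: "open U" "T = blinfun_apply -` U" and \<phi>U: "blinfun_apply \<phi> \<in> U"
    unfolding strong_operator_topology_def openin_pullback_topology by auto
  from U(1) have "openin (product_topology (\<lambda>i. euclidean) UNIV) U"
    by (simp add: open_fun_def)
  from product_topology_open_contains_basis[OF this \<phi>U]
  obtain X where X: "blinfun_apply \<phi> \<in> Pi\<^sub>E UNIV X" "\<And>i. open (X i)"
    "finite {i. X i \<noteq> UNIV}" "Pi\<^sub>E UNIV X \<subseteq> U"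
    by auto
  define F where "F = {i. X i \<noteq> UNIV}"
  have "\<exists>r>0. ball (\<phi> i) r \<subseteq> X i" for i
    using X(1) X(2)[of i] by (auto simp: open_contains_ball PiE_def)
  then obtain r where r: "\<And>i. 0 < r i" "\<And>i. ball (\<phi> i) (r i) \<subseteq> X i" by metis
  define e where "e = Min (insert 1 (r ` F))"
  have F: "finite F" using X(3) by (simp add: F_def)
  have "0 < e" using F r(1) by (simp add: e_def)
  from approx[OF F this] obtain \<psi> where \<psi>: "\<psi> \<in> S" "\<And>f. f \<in> F \<Longrightarrow> \<bar>\<phi> f - \<psi> f\<bar> < e" by blast
  have "\<psi> i \<in> X i" for i
  proof (cases "i \<in> F")
    case True
    then have "e \<le> r i" using F by (simp add: e_def)
    with \<psi>(2)[OF True] have "\<psi> i \<in> ball (\<phi> i) (r i)" by (simp add: dist_real_def)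
    then show ?thesis using r(2) by blast
  qed (simp add: F_def)
  then have "\<psi> \<in> T" using X(4) U(2) by (auto simp: PiE_def)
  with \<psi>(1) show "\<exists>y. y \<in> S \<and> y \<in> T" by blast
qed

lemma norm_canonical_embedding_le: "norm (canonical_embedding x) \<le> norm x"
proof (rule norm_blinfun_bound)
  show "norm (canonical_embedding x f) \<le> norm x * norm f" for f
    using norm_blinfun[of f x] by (simp add: mult.commute)
qed simp

theorem theoremA1:
  fixes P :: "'a::banach set"
  assumes "closed P" and "wedge P"
  shows "canonical_embedding ` positive_unit_ball P
           \<subseteq> positive_unit_ball (dual_wedge (dual_wedge P))
       \<and> positive_unit_ball (dual_wedge (dual_wedge P))
           \<subseteq> weak_star_topology closure_of (canonical_embedding ` positive_unit_ball P)"
proof (intro conjI subsetI)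
  fix \<phi> assume "\<phi> \<in> canonical_embedding ` positive_unit_ball P"
  then show "\<phi> \<in> positive_unit_ball (dual_wedge (dual_wedge P))"
    using norm_canonical_embedding_le order_trans
    by (fastforce simp: positive_unit_ball_def dual_wedge_def)
next
  fix \<phi> assume \<phi>: "\<phi> \<in> positive_unit_ball (dual_wedge (dual_wedge P))"
  show "\<phi> \<in> weak_star_topology closure_of (canonical_embedding ` positive_unit_ball P)"
  proof (rule weak_star_closure_ofI)
    fix F :: "('a \<Rightarrow>\<^sub>L real) set" and e :: real
    assume "finite F" "0 < e"
    then obtain x where "x \<in> positive_unit_ball P" "\<And>f. f \<in> F \<Longrightarrow> \<bar>\<phi> f - blinfun_apply f x\<bar> < e"
      by (rule bidual_approximation[OF assms(2) \<phi>]) blast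
    then show "\<exists>\<psi>\<in>canonical_embedding ` positive_unit_ball P. \<forall>f\<in>F. \<bar>\<phi> f - \<psi> f\<bar> < e"
      by auto
  qed
qed

end
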